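(* Let $G$ be any connected graph and let $U\subseteq V(G)$ be any vertex set. Then exactly one of the following two assertions holds: (i) $G$ contains a comb attached to $U$; (ii) for every infinite $U'\subseteq U$ there is a critical vertex set $X\subseteq V(G)$ such that infinitely many of the components in $\breve{\mathcal C}_X$ meet $U'$.
   Context: Graphs may be infinite. A ray is a one-way infinite path. A comb is the union of a ray $R$ (its spine) with infinitely many disjoint finite paths, possibly trivial, that have precisely their first vertex on $R$; the last vertices of these paths are its teeth. A comb attached to $U$ is a comb all of whose teeth lie in $U$. For a finite vertex set $X\subseteq V(G)$, $\breve{\mathcal C}_X$ denotes the set of those components $C$ of $G-X$ whose neighbourhood satisfies $N(C)=X$. A finite vertex set $X$ is critical if $\breve{\mathcal C}_X$ is infinite. *)

theory Defs
  imports Main "Graph_Theory.Digraph_Component_Vwalk"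
begin

text \<open>
  An undirected edge is a pair of opposite arcs, as in the locale \<^locale>\<open>graph\<close>, which
  however also requires finiteness. Here there may be infinitely many vertices and arcs.
\<close>

locale simple_graph = loopfree_digraph + nomulti_digraph + sym_digraph

text \<open>
  The subgraph may use only one of two opposite arcs, but maximality forces a component to be
  an induced, hence symmetric, subgraph. Components are nonempty because
  \<^const>\<open>connected\<close> graphs are.
\<close>

definition components :: "('a, 'b) pre_digraph \<Rightarrow> ('a, 'b) pre_digraph set" where
  "components G = {C. pre_digraph.max_subgraph G connected C}"

definition neighbourhood :: "('a, 'b) pre_digraph \<Rightarrow> 'a set \<Rightarrow> 'a set" where
  "neighbourhood G S = {v \<in> verts G - S. \<exists>u\<in>S. u \<rightarrow>\<^bsub>G\<^esub> v}"

definition breve_C :: "('a, 'b) pre_digraph \<Rightarrow> 'a set \<Rightarrow> ('a, 'b) pre_digraph set" where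
  "breve_C G X = {C \<in> components (G \<restriction> (verts G - X)). neighbourhood G (verts C) = X}"

definition critical :: "('a, 'b) pre_digraph \<Rightarrow> 'a set \<Rightarrow> bool" where
  "critical G X \<longleftrightarrow> finite X \<and> X \<subseteq> verts G \<and> infinite (breve_C G X)"

definition ray :: "('a, 'b) pre_digraph \<Rightarrow> (nat \<Rightarrow> 'a) \<Rightarrow> bool" where
  "ray G R \<longleftrightarrow> inj R \<and> (\<forall>n. R n \<in> verts G) \<and> (\<forall>n. R n \<rightarrow>\<^bsub>G\<^esub> R (Suc n))"

text \<open>
  A comb in a graph is given by its spine \<open>R\<close> and its set \<open>P\<close> of disjoint finite paths, each a
  nonempty list of distinct vertices; a trivial path is a list of length 1.
\<close>

definition comb :: "('a, 'b) pre_digraph \<Rightarrow> (nat \<Rightarrow> 'a) \<Rightarrow> 'a list set \<Rightarrow> bool" where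
  "comb G R P \<longleftrightarrow>
     ray G R \<and> infinite P \<and>
     (\<forall>p\<in>P. vpath p G \<and> set p \<inter> range R = {hd p}) \<and>
     pairwise (\<lambda>p q. disjnt (set p) (set q)) P"

definition teeth :: "'a list set \<Rightarrow> 'a set" where
  "teeth P = last ` P"

definition contains_comb_attached_to :: "('a, 'b) pre_digraph \<Rightarrow> 'a set \<Rightarrow> bool" where
  "contains_comb_attached_to G U \<longleftrightarrow> (\<exists>R P. comb G R P \<and> teeth P \<subseteq> U)"

end

theory Submission
  imports Defs
begin

text \<open>
  A finite set \<open>X\<close> meets only finitely many paths of a comb and an initial piece of its spine, so all
  but finitely many teeth lie in one component of \<open>G - X\<close>; hence the set of teeth violates (ii).

  Conversely, let \<open>W\<close> be an infinite subset of \<open>U\<close> for which no critical set as in (ii) exists. A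
  component of \<open>G - X\<close> with neighbourhood \<open>Y\<close> is also a component of \<open>G - Y\<close>. As a finite \<open>X\<close>
  has only finitely many subsets \<open>Y\<close>, only finitely many components of \<open>G - X\<close> meet \<open>W\<close>, and so
  any component that contains infinitely many vertices of \<open>W\<close> still has such a component inside it
  after a further finite set is deleted. Moving into ever smaller such components, one takes a path
  to a vertex of \<open>W\<close> and branches off from it into the next component: this builds a comb.
\<close>

section \<open>Components as reachability classes\<close>

text \<open>\<open>connected\<close> refers to the symmetric closure, so \<open>H\<close> may use
  just one of two opposite arcs. As \<open>G\<close> is symmetric, its own closure adds nothing to
  reachability.\<close>

lemma connected_imp_reachable:
  assumes "sym_digraph G" "subgraph H G" "connected H" "u \<in> verts H" "v \<in> verts H"
  shows "u \<rightarrow>\<^sup>*\<^bsub>G\<^esub> v"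
proof -
  interpret G: sym_digraph G by fact
  have "u \<rightarrow>\<^sup>*\<^bsub>with_proj (mk_symmetric H)\<^esub> v"
    using assms(3-5) by (auto simp: connected_def)
  then have "u \<rightarrow>\<^sup>*\<^bsub>with_proj (mk_symmetric G)\<^esub> v"
    using subgraph_mk_symmetric[OF assms(2)] by (rule pre_digraph.reachable_mono)
  then show ?thesis
    by (simp add: G.reachable_mk_symmetric_eq G.sym_arcs)
qed

text \<open>The graph induced on a reachability class is connected and contains every connected
  subgraph through its base point. Hence it is maximal, and every maximal connected subgraph is of
  this form.\<close>

lemma (in sym_digraph) components_conv:
  "components G = (\<lambda>u. G \<restriction> {v. u \<rightarrow>\<^sup>* v}) ` verts G"
proof -
  let ?K = "\<lambda>u. G \<restriction> {v. u \<rightarrow>\<^sup>* v}"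
  have K_sub: "subgraph (?K u) G" for u
    by (rule subgraph_induce_subgraphI) (auto dest: reachable_in_verts)
  have K_conn: "connected (?K u)" if "u \<in> verts G" for u
  proof -
    have ind: "induced_subgraph (?K u) G"
      by (rule induced_induce) (auto dest: reachable_in_verts)
    interpret K: sym_digraph "?K u" by (rule induced_graph_imp_graph[OF ind])
    \<comment> \<open>Inside the class \<open>u\<close> still reaches all vertices, so symmetry
      joins \<open>x\<close> to \<open>y\<close> through \<open>u\<close>.\<close>
    have "x \<rightarrow>\<^sup>*\<^bsub>?K u\<^esub> y" if "u \<rightarrow>\<^sup>* x" "u \<rightarrow>\<^sup>* y" for x y
      using that induce_reachable_preserves_paths K.symmetric_reachable' K.reachable_trans by blast
    then have "strongly_connected (?K u)"
      using that by (auto simp: strongly_connected_def)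
    then show ?thesis
      unfolding connected_def strongly_connected_def
      by (auto intro: K.reachable_mk_symmetricI)
  qed
  have sub_K: "subgraph H (?K u)" if "subgraph H G" "connected H" "u \<in> verts H" for H u
  proof (rule subgraphI)
    have "verts H \<subseteq> {v. u \<rightarrow>\<^sup>* v}"
      using connected_imp_reachable[OF sym_digraph_axioms that(1,2)] that(3) by blast
    then show "verts H \<subseteq> verts (?K u)" by simp
    interpret H: wf_digraph H using that by auto
    have tl: "tail H = tail G" "head H = head G" using that by (auto simp: compatible_def)
    show "arcs H \<subseteq> arcs (?K u)"
    proof
      fix e assume "e \<in> arcs H"
      then show "e \<in> arcs (?K u)"
        using that(1) H.tail_in_verts[of e] H.head_in_verts[of e] tl \<open>verts H \<subseteq> {v. u \<rightarrow>\<^sup>* v}\<close> by auto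
    qed
    show "compatible (?K u) H" using tl by (simp add: compatible_def)
    show "wf_digraph H" ..
    show "wf_digraph (?K u)" by auto
  qed
  \<comment> \<open>Mutual subgraphs agree as records, since \<open>compatible\<close> also equates
    their \<open>tail\<close> and \<open>head\<close> maps.\<close>
  have anti: "H = H'" if "subgraph H H'" "subgraph H' H" for H H' :: "('a, 'b) pre_digraph"
    using that by (auto simp: subgraph_def compatible_def intro!: pre_digraph.equality)
  show ?thesis
  proof safe
    fix C assume "C \<in> components G"
    then have C: "subgraph C G" "connected C" 
      and max: "\<And>H. H \<noteq> C \<Longrightarrow> subgraph C H \<Longrightarrow> \<not> (subgraph H G \<and> connected H)"
      by (auto simp: components_def max_subgraph_def)
    then obtain u where u: "u \<in> verts C"
      by (auto simp: connected_def strongly_connected_def)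
    then have "u \<in> verts G" using C by auto
    moreover have "C = ?K u"
      using max[OF _ sub_K[OF C u]] K_sub K_conn \<open>u \<in> verts G\<close> by metis
    ultimately show "C \<in> ?K ` verts G" by blast
  next
    fix u assume u: "u \<in> verts G"
    have "H = ?K u" if "subgraph (?K u) H" "subgraph H G" "connected H" for H
    proof (rule anti)
      have "u \<in> verts H" using that(1) u by (auto simp: subgraph_def)
      then show "subgraph H (?K u)" using that sub_K by blast
    qed (fact that)
    then show "?K u \<in> components G"
      using K_sub K_conn u by (auto simp: components_def max_subgraph_def)
  qed
qed

lemma (in sym_digraph) component_eq:
  assumes "C \<in> components G" "w \<in> verts C"
  shows "C = G \<restriction> {v. w \<rightarrow>\<^sup>* v}"
proof -
  obtain u where u: "C = G \<restriction> {v. u \<rightarrow>\<^sup>* v}"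
    using assms(1) unfolding components_conv by auto
  with assms(2) have "u \<rightarrow>\<^sup>* w" by simp
  then have "{v. u \<rightarrow>\<^sup>* v} = {v. w \<rightarrow>\<^sup>* v}"
    using symmetric_reachable' reachable_trans by blast
  with u show ?thesis by simp
qed

text \<open>A component is determined by any one of its vertices in \<open>W\<close>.\<close>

lemma (in sym_digraph) finite_components_meeting:
  assumes "finite W"
  shows "finite {C \<in> components G. verts C \<inter> W \<noteq> {}}"
proof (rule finite_subset)
  show "{C \<in> components G. verts C \<inter> W \<noteq> {}} \<subseteq> (\<lambda>w. G \<restriction> {v. w \<rightarrow>\<^sup>* v}) ` W"
    using component_eq by blast
qed (simp add: assms)

section \<open>Components after the deletion of a vertex set\<close>

lemma (in sym_digraph) sym_digraph_induce:
  "S \<subseteq> verts G \<Longrightarrow> sym_digraph (G \<restriction> S)"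
  by (rule induced_graph_imp_graph) (rule induced_induce)

lemma dominates_induce_iff:
  "u \<rightarrow>\<^bsub>G \<restriction> S\<^esub> v \<longleftrightarrow> u \<rightarrow>\<^bsub>G\<^esub> v \<and> u \<in> S \<and> v \<in> S"
  by (auto simp: arcs_ends_conv)

lemma induce_induce: "T \<subseteq> S \<Longrightarrow> (G \<restriction> S) \<restriction> T = G \<restriction> T"
  by (auto simp: induce_subgraph_def)

text \<open>Putting the vertices of \<open>X - Y\<close> back does not enlarge \<open>C\<close>: a
  walk that leaves \<open>C\<close> must enter its neighbourhood \<open>Y\<close>, which remains
  deleted.\<close>

lemma (in sym_digraph) component_in_breve_C:
  assumes C: "C \<in> components (G \<restriction> (verts G - X))" and N: "neighbourhood G (verts C) = Y"
    and "Y \<subseteq> X"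
  shows "C \<in> breve_C G Y"
proof -
  interpret X: sym_digraph "G \<restriction> (verts G - X)" by (rule sym_digraph_induce) auto
  interpret Y: sym_digraph "G \<restriction> (verts G - Y)" by (rule sym_digraph_induce) auto
  define S where "S = verts C"
  obtain u where u: "u \<in> verts G - X" and Cu: "C = (G \<restriction> (verts G - X)) \<restriction> {v. u \<rightarrow>\<^sup>*\<^bsub>G \<restriction> (verts G - X)\<^esub> v}"
    using C unfolding X.components_conv by auto
  then have S: "S = {v. u \<rightarrow>\<^sup>*\<^bsub>G \<restriction> (verts G - X)\<^esub> v}" by (simp add: S_def)
  have SX: "S \<subseteq> verts G - X" using X.reachable_in_verts(2) unfolding S by auto
  have "S = {v. u \<rightarrow>\<^sup>*\<^bsub>G \<restriction> (verts G - Y)\<^esub> v}"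
  proof safe
    fix v assume "v \<in> S"
    then show "u \<rightarrow>\<^sup>*\<^bsub>G \<restriction> (verts G - Y)\<^esub> v"
      unfolding S using \<open>Y \<subseteq> X\<close> by (auto intro: reachable_induce_ss)
  next
    fix v assume "u \<rightarrow>\<^sup>*\<^bsub>G \<restriction> (verts G - Y)\<^esub> v"
    then show "v \<in> S"
    proof (induction rule: Y.reachable_induct)
      case base
      then show ?case using u by (simp add: S)
    next
      case (step x y)
      then show ?case using N by (auto simp: S_def neighbourhood_def dominates_induce_iff)
    qed
  qed
  moreover have "C = G \<restriction> S"
    using Cu SX unfolding S[symmetric] by (simp add: induce_induce)
  moreover have "S \<subseteq> verts G - Y" using SX \<open>Y \<subseteq> X\<close> by blast
  ultimately have "C = (G \<restriction> (verts G - Y)) \<restriction> {v. u \<rightarrow>\<^sup>*\<^bsub>G \<restriction> (verts G - Y)\<^esub> v}"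
    by (metis induce_induce)
  then have "C \<in> components (G \<restriction> (verts G - Y))"
    using u \<open>Y \<subseteq> X\<close> unfolding Y.components_conv by auto
  with N show ?thesis by (simp add: breve_C_def)
qed

text \<open>A neighbour outside \<open>X\<close> would be reachable in \<open>G - X\<close> and so
  belong to \<open>C\<close>.\<close>

lemma (in sym_digraph) neighbourhood_component_subset:
  assumes "C \<in> components (G \<restriction> (verts G - X))"
  shows "neighbourhood G (verts C) \<subseteq> X"
proof -
  interpret X: sym_digraph "G \<restriction> (verts G - X)" by (rule sym_digraph_induce) auto
  obtain u where Cu: "verts C = {v. u \<rightarrow>\<^sup>*\<^bsub>G \<restriction> (verts G - X)\<^esub> v}"
    using assms unfolding X.components_conv by auto
  have "v \<in> verts C" if "x \<in> verts C" "x \<rightarrow>\<^bsub>G\<^esub> v" "v \<in> verts G - X" for x v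
  proof -
    have "x \<rightarrow>\<^bsub>G \<restriction> (verts G - X)\<^esub> v"
      using that X.reachable_in_verts(2)[of u x] by (simp add: dominates_induce_iff Cu)
    moreover have "u \<rightarrow>\<^sup>*\<^bsub>G \<restriction> (verts G - X)\<^esub> x" using that(1) by (simp add: Cu)
    ultimately show ?thesis using X.reachable_adj_trans by (simp add: Cu)
  qed
  then show ?thesis by (auto simp: neighbourhood_def)
qed

text \<open>Pigeonhole: the neighbourhoods of these components are subsets of the finite set
  \<open>X\<close>, so infinitely many components share one neighbourhood, and this is the critical
  set.\<close>

lemma (in sym_digraph) ex_critical:
  assumes "finite X" and inf: "infinite {C \<in> components (G \<restriction> (verts G - X)). verts C \<inter> W \<noteq> {}}"
  shows "\<exists>Y. critical G Y \<and> infinite {C \<in> breve_C G Y. verts C \<inter> W \<noteq> {}}"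
proof -
  let ?A = "{C \<in> components (G \<restriction> (verts G - X)). verts C \<inter> W \<noteq> {}}"
  let ?N = "\<lambda>C. neighbourhood G (verts C)"
  have "?N ` ?A \<subseteq> Pow X" using neighbourhood_component_subset by blast
  then have "finite (?N ` ?A)" using \<open>finite X\<close> finite_subset by blast
  from pigeonhole_infinite[OF inf this] obtain C0 where
    C0: "C0 \<in> ?A" and inf': "infinite {C \<in> ?A. ?N C = ?N C0}" by blast
  let ?Y = "?N C0"
  have Y: "?Y \<subseteq> X" using C0 neighbourhood_component_subset by blast
  have "{C \<in> ?A. ?N C = ?Y} \<subseteq> {C \<in> breve_C G ?Y. verts C \<inter> W \<noteq> {}}"
    using component_in_breve_C Y by blast
  then have *: "infinite {C \<in> breve_C G ?Y. verts C \<inter> W \<noteq> {}}"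
    using inf' finite_subset by blast
  have "infinite (breve_C G ?Y)"
    by (rule infinite_super[OF _ *]) auto
  moreover have "?Y \<subseteq> verts G" by (auto simp: neighbourhood_def)
  ultimately show ?thesis
    using * finite_subset[OF Y \<open>finite X\<close>] unfolding critical_def by blast
qed

section \<open>Components that contain teeth of a comb\<close>

text \<open>Choosing a vertex of \<open>X\<close> on each such path is injective by
  disjointness.\<close>

lemma finite_meeting_disjoint:
  assumes "pairwise (\<lambda>p q. disjnt (set p) (set q)) P" "finite X"
  shows "finite {p \<in> P. set p \<inter> X \<noteq> {}}"
proof (rule inj_on_finite)
  define f where "f p = (SOME x. x \<in> set p \<inter> X)" for p
  have f: "f p \<in> set p \<inter> X" if "set p \<inter> X \<noteq> {}" for p
    unfolding f_def some_in_eq by (fact that)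
  show "inj_on f {p \<in> P. set p \<inter> X \<noteq> {}}"
  proof (rule inj_onI, rule ccontr)
    fix p q assume p: "p \<in> {p \<in> P. set p \<inter> X \<noteq> {}}" and q: "q \<in> {p \<in> P. set p \<inter> X \<noteq> {}}"
      and "f p = f q" "p \<noteq> q"
    then have "f p \<in> set p \<inter> set q" using f[of p] f[of q] by simp
    moreover have "disjnt (set p) (set q)"
      using p q \<open>p \<noteq> q\<close> pairwiseD[OF assms(1)] by blast
    ultimately show False by (auto simp: disjnt_def)
  qed
  show "f ` {p \<in> P. set p \<inter> X \<noteq> {}} \<subseteq> X" using f by blast
qed fact

lemma (in wf_digraph) vwalk_induce:
  "vwalk p G \<Longrightarrow> set p \<subseteq> S \<Longrightarrow> vwalk p (G \<restriction> S)"
  by (induction rule: vwalk_induct)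
    (auto simp: wf_digraph.vwalk_Cons_Cons[OF wellformed_induce_subgraph] dominates_induce_iff)

text \<open>All but finitely many paths avoid \<open>X\<close> and start on a tail of the spine that
  avoids \<open>X\<close>. Their teeth lie in the component of \<open>R N\<close>; each other tooth
  accounts for at most one further component.\<close>

lemma (in sym_digraph) comb_tooth_components_finite:
  assumes comb: "comb G R P" and X: "finite X"
  shows "finite {C \<in> components (G \<restriction> (verts G - X)). verts C \<inter> teeth P \<noteq> {}}"
proof -
  let ?D = "G \<restriction> (verts G - X)"
  interpret X: sym_digraph ?D by (rule sym_digraph_induce) auto
  have R: "inj R" "\<And>n. R n \<in> verts G" "\<And>n. R n \<rightarrow>\<^bsub>G\<^esub> R (Suc n)"
    and P: "\<And>p. p \<in> P \<Longrightarrow> vpath p G" "\<And>p. p \<in> P \<Longrightarrow> set p \<inter> range R = {hd p}"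
    and disj: "pairwise (\<lambda>p q. disjnt (set p) (set q)) P"
    using comb by (auto simp: comb_def ray_def)
  \<comment> \<open>As \<open>R\<close> is injective, it meets \<open>X\<close> only finitely often;
    \<open>N\<close> exceeds all indices where it does.\<close>
  have "finite {n. R n \<in> X}" using finite_vimageI[OF X R(1)] by (simp add: vimage_def)
  then obtain N where N: "\<And>n. R n \<in> X \<Longrightarrow> n < N"
    using finite_nat_bounded[of "{n. R n \<in> X}"] by auto
  \<comment> \<open>The initial piece of the spine is added so that paths avoiding \<open>Y\<close>
    start at an index at least \<open>N\<close>.\<close>
  define Y where "Y = X \<union> R ` {..<N}"
  define Q where "Q = {p \<in> P. set p \<inter> Y \<noteq> {}}"
  have fin: "finite (insert (R N) (last ` Q))"
    unfolding Q_def using finite_meeting_disjoint[OF disj, of Y] X by (auto simp: Y_def)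
  have ray: "R N \<rightarrow>\<^sup>*\<^bsub>?D\<^esub> R n" if "N \<le> n" for n
    using that
  proof (induction rule: dec_induct)
    case base
    then show ?case using R(2) N by (intro X.reachable_refl) force
  next
    case (step n)
    have "R n \<rightarrow>\<^bsub>?D\<^esub> R (Suc n)"
      using R(2,3)[of n] R(2)[of "Suc n"] step(1) N[of n] N[of "Suc n"]
      unfolding dominates_induce_iff by auto
    then show ?case using step X.reachable_adj_trans by blast
  qed
  have tooth: "R N \<rightarrow>\<^sup>*\<^bsub>?D\<^esub> last p" if "p \<in> P - Q" for p
  proof -
    have p: "set p \<inter> Y = {}" using that by (auto simp: Q_def)
    have "hd p \<in> set p \<inter> range R" using P(2)[of p] that by simp
    then obtain n where n: "hd p = R n" "R n \<in> set p" by auto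
    then have "N \<le> n" using p by (force simp: Y_def)
    have "vwalk p ?D"
      using P(1)[of p] that p by (intro vwalk_induce) (auto simp: Y_def vpath_def vwalk_def)
    then have "hd p \<rightarrow>\<^sup>*\<^bsub>?D\<^esub> last p" using X.reachable_vwalk_conv by blast
    then show ?thesis using ray[OF \<open>N \<le> n\<close>] n X.reachable_trans by metis
  qed
  have "{C \<in> components ?D. verts C \<inter> teeth P \<noteq> {}}
    \<subseteq> {C \<in> components ?D. verts C \<inter> insert (R N) (last ` Q) \<noteq> {}}"
  proof safe
    fix C x assume C: "C \<in> components ?D" and x: "x \<in> verts C" "x \<in> teeth P"
      and none: "verts C \<inter> insert (R N) (last ` Q) = {}"
    obtain p where p: "p \<in> P" "x = last p" using x by (auto simp: teeth_def)
    with none x have "p \<in> P - Q" by blast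
    then have "x \<rightarrow>\<^sup>*\<^bsub>?D\<^esub> R N" using p tooth X.symmetric_reachable' by blast
    moreover have "verts C = {v. x \<rightarrow>\<^sup>*\<^bsub>?D\<^esub> v}"
      using arg_cong[OF X.component_eq[OF C x(1)], of verts] by simp
    ultimately show False using none by blast
  qed
  then show ?thesis using X.finite_components_meeting[OF fin] finite_subset by blast
qed

lemma comb_imp_infinite_teeth:
  assumes "comb G R P"
  shows "infinite (teeth P)"
proof -
  have "inj_on last P"
  proof (rule inj_onI, rule ccontr)
    fix p q assume *: "p \<in> P" "q \<in> P" "last p = last q" "p \<noteq> q"
    then have "p \<noteq> []" "q \<noteq> []"
      using assms by (auto simp: comb_def vpath_def vwalk_def)
    then have "last p \<in> set p \<inter> set q"
      using *(3) last_in_set by (metis IntI)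
    moreover have "disjnt (set p) (set q)"
      using assms * by (auto simp: comb_def dest: pairwiseD)
    ultimately show False by (auto simp: disjnt_def)
  qed
  then show ?thesis
    using assms by (auto simp: teeth_def comb_def dest: finite_imageD)
qed

section \<open>Concatenating finite paths to a ray\<close>

lemma vwalk_nth_dominates:
  "vwalk xs G \<Longrightarrow> Suc i < length xs \<Longrightarrow> xs ! i \<rightarrow>\<^bsub>G\<^esub> xs ! Suc i"
proof (induction xs arbitrary: i)
  case (Cons x xs)
  then have xs: "xs \<noteq> []" by auto
  then have "x \<rightarrow>\<^bsub>G\<^esub> hd xs" "vwalk xs G" using Cons.prems by (auto elim: vwalk_consE)
  then show ?case using Cons xs by (cases i) (auto simp: hd_conv_nth)
qed simp

text \<open>The ray runs through \<open>S 0\<close>, \<open>S 1\<close>, ... in turn; distinctness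
  within the paths and disjointness between them make it injective.\<close>

lemma ray_of_paths:
  assumes path: "\<And>n. vpath (S n) G"
    and disj: "\<And>m n. m \<noteq> n \<Longrightarrow> set (S m) \<inter> set (S n) = {}"
    and link: "\<And>n. last (S n) \<rightarrow>\<^bsub>G\<^esub> hd (S (Suc n))"
  obtains R where "ray G R" "range R = (\<Union>n. set (S n))"
proof -
  \<comment> \<open>A pair \<open>(n, i)\<close> stands for vertex \<open>i\<close> of path
    \<open>n\<close>. After the last vertex of a path, \<open>nxt\<close> jumps to the start of the
    next one, which exists since no path is empty.\<close>
  define nxt where "nxt = (\<lambda>(n, i). if Suc i < length (S n) then (n, Suc i) else (Suc n, 0))"
  define pos where "pos k = (nxt ^^ k) (0, 0)" for k
  define R where "R k = S (fst (pos k)) ! snd (pos k)" for k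
  \<comment> \<open>The number of positions before \<open>(n, i)\<close>. It is a left inverse of
    \<open>pos\<close>, so no position is visited twice.\<close>
  define idx where "idx = (\<lambda>(n, i). (\<Sum>j<n. length (S j)) + i)"
  have ne: "S n \<noteq> []" and walk: "vwalk (S n) G" and dist: "distinct (S n)" for n
    using path[of n] by (auto simp: vpath_def vwalk_def)
  have pos_Suc: "pos (Suc k) = nxt (pos k)" for k by (simp add: pos_def)
  have valid: "snd (pos k) < length (S (fst (pos k)))" for k
  proof (induction k)
    case 0
    then show ?case using ne by (simp add: pos_def)
  next
    case (Suc k)
    then show ?case using ne by (auto simp: pos_Suc nxt_def split: prod.splits)
  qed
  have idx_pos: "idx (pos k) = k" for k
  proof (induction k)
    case 0
    then show ?case by (simp add: pos_def idx_def)
  next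
    case (Suc k)
    obtain n i where ni: "pos k = (n, i)" by force
    show ?case
    proof (cases "Suc i < length (S n)")
      case False
      then have "length (S n) = Suc i" using valid[of k] ni by simp
      then show ?thesis using Suc ni False by (simp add: pos_Suc nxt_def idx_def)
    qed (use Suc ni in \<open>simp add: pos_Suc nxt_def idx_def\<close>)
  qed
  have "inj R"
  proof (rule injI)
    fix j k assume eq: "R j = R k"
    have "R j \<in> set (S (fst (pos j)))" "R k \<in> set (S (fst (pos k)))"
      using valid by (simp_all add: R_def)
    then have "fst (pos j) = fst (pos k)" using eq disj by auto
    moreover from this have "snd (pos j) = snd (pos k)"
      using eq valid[of j] valid[of k] dist by (simp add: R_def nth_eq_iff_index_eq)
    ultimately have "pos j = pos k" by (simp add: prod_eq_iff)
    then show "j = k" using idx_pos by metis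
  qed
  moreover have "R k \<in> verts G" for k
    using vwalk_verts_in_verts[OF walk nth_mem[OF valid[of k]]] by (simp add: R_def)
  moreover have "R k \<rightarrow>\<^bsub>G\<^esub> R (Suc k)" for k
  proof -
    obtain n i where ni: "pos k = (n, i)" by force
    show ?thesis
    proof (cases "Suc i < length (S n)")
      case True
      then show ?thesis
        using vwalk_nth_dominates[OF walk] ni by (simp add: R_def pos_Suc nxt_def)
    next
      case False
      then have "i = length (S n) - 1" using valid[of k] ni by simp
      then show ?thesis
        using link[of n] ne ni False
        by (simp add: R_def pos_Suc nxt_def last_conv_nth hd_conv_nth)
    qed
  qed
  moreover have "range R = (\<Union>n. set (S n))"
  proof
    show "range R \<subseteq> (\<Union>n. set (S n))" using nth_mem[OF valid] unfolding R_def by blast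
    \<comment> \<open>Every position is visited: \<open>step\<close> runs along a path from its
      start, and \<open>start\<close> passes from its end to the start of the next path.\<close>
    have step: "\<exists>k. pos k = (n, i)" if "i < length (S n)" "pos k0 = (n, 0)" for n i k0
      using that(1)
    proof (induction i)
      case 0
      then show ?case using that(2) by blast
    next
      case (Suc i)
      then obtain k where "pos k = (n, i)" by auto
      then have "pos (Suc k) = (n, Suc i)" using Suc.prems by (simp add: pos_Suc nxt_def)
      then show ?case by blast
    qed
    have start: "\<exists>k. pos k = (n, 0)" for n
    proof (induction n)
      case 0
      have "pos 0 = (0, 0)" by (simp add: pos_def)
      then show ?case by blast
    next
      case (Suc n)
      then obtain k where "pos k = (n, length (S n) - 1)"
        using step[of "length (S n) - 1" n] ne[of n] by auto
      then have "pos (Suc k) = (Suc n, 0)" by (simp add: pos_Suc nxt_def)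
      then show ?case by blast
    qed
    show "(\<Union>n. set (S n)) \<subseteq> range R"
    proof
      fix x assume "x \<in> (\<Union>n. set (S n))"
      then obtain n i where ni: "i < length (S n)" "x = S n ! i" by (auto simp: in_set_conv_nth)
      obtain k where "pos k = (n, i)" using start step ni by blast
      then have "x = R k" using ni by (simp add: R_def)
      then show "x \<in> range R" by blast
    qed
  qed
  ultimately show thesis by (intro that) (auto simp: ray_def)
qed

section \<open>Recursive construction of a comb\<close>

text \<open>
  Up to \<open>q\<close> the path extends the spine; from \<open>q\<close> on it leads to a tooth. The spine continues at
  \<open>w'\<close>, in a component that avoids everything used so far.
\<close>

lemma (in sym_digraph) extend_comb:
  assumes "finite X"
    and fin: "\<And>X. finite X \<Longrightarrow> finite {C \<in> components (G \<restriction> (verts G - X)). verts C \<inter> W \<noteq> {}}"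
    and inf: "infinite {v \<in> W. w \<rightarrow>\<^sup>*\<^bsub>G \<restriction> (verts G - X)\<^esub> v}"
  shows "\<exists>A q B w'. hd (A @ q # B) = w \<and> vpath (A @ q # B) G \<and> set (A @ q # B) \<inter> X = {} \<and>
    last (A @ q # B) \<in> W \<and> q \<rightarrow>\<^bsub>G\<^esub> w' \<and>
    infinite {v \<in> W. w' \<rightarrow>\<^sup>*\<^bsub>G \<restriction> (verts G - (X \<union> set (A @ q # B)))\<^esub> v}"
proof -
  let ?D = "\<lambda>X. G \<restriction> (verts G - X)"
  interpret D: sym_digraph "?D X" by (rule sym_digraph_induce) auto
  obtain u where u: "u \<in> W" "w \<rightarrow>\<^sup>*\<^bsub>?D X\<^esub> u"
    using infinite_imp_nonempty[OF inf] by blast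
  obtain Q where Q: "vpath Q (?D X)" "hd Q = w" "last Q = u"
    using u by (auto simp: D.reachable_vpath_conv)
  have "vpath Q G"
    using Q(1) by (rule vpathI_subgraph) (rule subgraph_induce_subgraphI, auto)
  have QX: "set Q \<inter> X = {}" and wQ: "w \<in> set Q" using Q by (auto simp: vpath_def vwalk_def)
  \<comment> \<open>All of \<open>Q\<close> is deleted, including the piece after \<open>q\<close>,
    so that later paths avoid both the spine and the way to the tooth.\<close>
  define X' where "X' = X \<union> set Q"
  interpret D': sym_digraph "?D X'" by (rule sym_digraph_induce) auto
  have "finite X'" using \<open>finite X\<close> by (simp add: X'_def)
  \<comment> \<open>Removing the finite path leaves infinitely many vertices of \<open>W\<close>.
    They are spread over finitely many components of \<open>G - X'\<close>, so one component
    \<open>C\<close> has infinitely many of them.\<close>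
  define Z where "Z = {v \<in> W. w \<rightarrow>\<^sup>*\<^bsub>?D X\<^esub> v} - set Q"
  have "infinite Z" using inf by (simp add: Z_def)
  have ZV: "Z \<subseteq> verts G - X'" using D.reachable_in_verts(2) by (auto simp: Z_def X'_def)
  let ?\<C> = "{C \<in> components (?D X'). verts C \<inter> W \<noteq> {}}"
  have "Z \<subseteq> (\<Union>C\<in>?\<C>. verts C \<inter> Z)"
  proof
    fix v assume v: "v \<in> Z"
    define K where "K = ?D X' \<restriction> {x. v \<rightarrow>\<^sup>*\<^bsub>?D X'\<^esub> x}"
    have "v \<rightarrow>\<^sup>*\<^bsub>?D X'\<^esub> v" using v ZV by (intro D'.reachable_refl) auto
    then have "v \<in> verts K" by (simp add: K_def)
    moreover have "K \<in> components (?D X')"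
      unfolding K_def D'.components_conv using v ZV by (intro imageI) auto
    moreover have "v \<in> W" using v by (simp add: Z_def)
    ultimately show "v \<in> (\<Union>C\<in>?\<C>. verts C \<inter> Z)" using v by blast
  qed
  then have "\<not> finite (\<Union>C\<in>?\<C>. verts C \<inter> Z)" using \<open>infinite Z\<close> finite_subset by blast
  then obtain C where C: "C \<in> components (?D X')" "infinite (verts C \<inter> Z)"
    using fin[OF \<open>finite X'\<close>] by blast
  then obtain d where d: "d \<in> verts C" "d \<in> Z"
    using infinite_imp_nonempty by blast
  \<comment> \<open>On a walk from \<open>w\<close> to \<open>x\<close>, the vertex \<open>q\<close>
    is the last one on \<open>Q\<close> and \<open>w'\<close> is its successor; from
    \<open>w'\<close> on the walk avoids \<open>Q\<close>.\<close>
  have first_exit: "\<exists>q w'. q \<in> set Q \<and> q \<rightarrow>\<^bsub>G\<^esub> w' \<and> w' \<rightarrow>\<^sup>*\<^bsub>?D X'\<^esub> x"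
    if "w \<rightarrow>\<^sup>*\<^bsub>?D X\<^esub> x" "x \<notin> set Q" for x
    using that
  proof (induction rule: D.reachable_induct)
    case base
    then show ?case using wQ by blast
  next
    case (step x y)
    have y: "y \<in> verts G - X'" "x \<rightarrow>\<^bsub>G\<^esub> y" "x \<in> verts G - X"
      using step by (auto simp: dominates_induce_iff X'_def)
    show ?case
    proof (cases "x \<in> set Q")
      case True
      then show ?thesis using y by (intro exI[of _ x] exI[of _ y]) auto
    next
      case False
      have "x \<rightarrow>\<^bsub>?D X'\<^esub> y" using y False by (auto simp: dominates_induce_iff X'_def)
      then show ?thesis using step.IH[OF False] D'.reachable_adj_trans by blast
    qed
  qed
  obtain q w' where q: "q \<in> set Q" "q \<rightarrow>\<^bsub>G\<^esub> w'" "w' \<rightarrow>\<^sup>*\<^bsub>?D X'\<^esub> d"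
    using first_exit[of d] d by (auto simp: Z_def)
  have "verts C \<inter> Z \<subseteq> {v \<in> W. w' \<rightarrow>\<^sup>*\<^bsub>?D X'\<^esub> v}"
  proof
    fix v assume v: "v \<in> verts C \<inter> Z"
    have "verts C = {v. d \<rightarrow>\<^sup>*\<^bsub>?D X'\<^esub> v}"
      using arg_cong[OF D'.component_eq[OF C(1) d(1)], of verts] by simp
    then show "v \<in> {v \<in> W. w' \<rightarrow>\<^sup>*\<^bsub>?D X'\<^esub> v}"
      using v q(3) D'.reachable_trans by (auto simp: Z_def)
  qed
  then have "infinite {v \<in> W. w' \<rightarrow>\<^sup>*\<^bsub>?D X'\<^esub> v}" using C(2) finite_subset by blast
  moreover obtain A B where "Q = A @ q # B" using q(1) split_list by metis
  ultimately show ?thesis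
    using Q u q(2) QX \<open>vpath Q G\<close> by (intro exI[of _ A] exI[of _ q] exI[of _ B] exI[of _ w']) (simp add: X'_def)
qed

text \<open>Iterating \<open>extend_comb\<close> by dependent choice yields disjoint paths. Their
  pieces up to \<open>q\<close> link up to the spine, and the pieces from \<open>q\<close> on lead
  to the teeth.\<close>

lemma (in sym_digraph) ex_comb:
  assumes "connected G" "W \<subseteq> verts G" "infinite W"
    and fin: "\<And>X. finite X \<Longrightarrow> finite {C \<in> components (G \<restriction> (verts G - X)). verts C \<inter> W \<noteq> {}}"
  shows "contains_comb_attached_to G W"
proof -
  \<comment> \<open>\<open>X\<close> stands for the vertices of earlier paths and
    \<open>A @ q # B\<close> for the current path. The neighbour \<open>w\<close> of
    \<open>q\<close> still reaches infinitely many vertices of \<open>W\<close> after all these are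
    deleted.\<close>
  define inv where "inv = (\<lambda>(X, A, q, B). finite X \<and> vpath (A @ q # B) G \<and> set (A @ q # B) \<inter> X = {} \<and>
    last (A @ q # B) \<in> W \<and>
    (\<exists>w. q \<rightarrow>\<^bsub>G\<^esub> w \<and> infinite {v \<in> W. w \<rightarrow>\<^sup>*\<^bsub>G \<restriction> (verts G - (X \<union> set (A @ q # B)))\<^esub> v}))"
  define succ where "succ = (\<lambda>(X, A, q, B) (X', A', q', B').
    X' = X \<union> set (A @ q # B) \<and> q \<rightarrow>\<^bsub>G\<^esub> hd (A' @ q' # B'))"
  have start: "\<exists>s. inv s"
  proof -
    obtain w where w: "w \<in> W" using \<open>infinite W\<close> infinite_imp_nonempty by blast
    have all: "w \<rightarrow>\<^sup>* v" if "v \<in> W" for v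
      using connected_imp_reachable[OF sym_digraph_axioms subgraph_refl \<open>connected G\<close>] that w assms(2)
      by blast
    \<comment> \<open>The recursion starts with nothing deleted, where connectedness makes all of
      \<open>W\<close> reachable from \<open>w\<close>.\<close>
    have "u \<rightarrow>\<^bsub>G \<restriction> (verts G - {})\<^esub> v \<longleftrightarrow> u \<rightarrow>\<^bsub>G\<^esub> v" for u v
      using adj_in_verts by (auto simp: dominates_induce_iff)
    then have "arcs_ends (G \<restriction> (verts G - {})) = arcs_ends G" by auto
    then have "{v \<in> W. w \<rightarrow>\<^sup>*\<^bsub>G \<restriction> (verts G - {})\<^esub> v} = W"
      using all by (auto simp: reachable_def)
    then have "infinite {v \<in> W. w \<rightarrow>\<^sup>*\<^bsub>G \<restriction> (verts G - {})\<^esub> v}" using \<open>infinite W\<close> by metis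
    from extend_comb[OF finite.emptyI fin this] obtain A q B where "inv ({}, A, q, B)"
      unfolding inv_def by fastforce
    then show ?thesis by blast
  qed
  have next_ex: "\<exists>s'. inv s' \<and> succ s s'" if "inv s" for s
  proof -
    note inv = that
    obtain X A q B where s: "s = (X, A, q, B)" by (cases s)
    let ?X' = "X \<union> set (A @ q # B)"
    have "finite ?X'" using inv by (simp add: inv_def s)
    obtain w where w: "q \<rightarrow>\<^bsub>G\<^esub> w" "infinite {v \<in> W. w \<rightarrow>\<^sup>*\<^bsub>G \<restriction> (verts G - ?X')\<^esub> v}"
      using inv unfolding s inv_def prod.case by blast
    from extend_comb[OF \<open>finite ?X'\<close> fin w(2)] obtain A' q' B' w' where
      "hd (A' @ q' # B') = w" "vpath (A' @ q' # B') G" "set (A' @ q' # B') \<inter> ?X' = {}"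
      "last (A' @ q' # B') \<in> W" "q' \<rightarrow>\<^bsub>G\<^esub> w'"
      "infinite {v \<in> W. w' \<rightarrow>\<^sup>*\<^bsub>G \<restriction> (verts G - (?X' \<union> set (A' @ q' # B')))\<^esub> v}"
      by blast
    then have "inv (?X', A', q', B')" "succ s (?X', A', q', B')"
      using \<open>finite ?X'\<close> w(1) unfolding s inv_def succ_def prod.case by (blast, simp)
    then show ?thesis by blast
  qed
  obtain s where s: "\<And>n. inv (s n)" "\<And>n. succ (s n) (s (Suc n))"
    using dependent_nat_choice[of "\<lambda>_. inv" "\<lambda>_. succ"] start next_ex by metis
  define X A q B where "X n = fst (s n)" and "A n = fst (snd (s n))"
    and "q n = fst (snd (snd (s n)))" and "B n = snd (snd (snd (s n)))" for n
  define Q where "Q n = A n @ q n # B n" for n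
  have s_eq: "s n = (X n, A n, q n, B n)" for n
    by (simp add: X_def A_def q_def B_def)
  have Q: "vpath (Q n) G" "set (Q n) \<inter> X n = {}" "last (Q n) \<in> W"
    "X (Suc n) = X n \<union> set (Q n)" "q n \<rightarrow>\<^bsub>G\<^esub> hd (Q (Suc n))" for n
    using s(1)[of n] s(2)[of n] unfolding s_eq Q_def inv_def succ_def by auto
  have X_mono: "m \<le> n \<Longrightarrow> X m \<subseteq> X n" for m n
    by (rule lift_Suc_mono_le[of X]) (simp add: Q(4))
  have Q_disj: "set (Q m) \<inter> set (Q n) = {}" if "m \<noteq> n" for m n
  proof -
    \<comment> \<open>For \<open>m < n\<close>, the vertices of \<open>Q m\<close> lie in
      \<open>X (Suc m)\<close>, hence in \<open>X n\<close>, which \<open>Q n\<close>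
      avoids.\<close>
    have *: "set (Q m) \<inter> set (Q n) = {}" if "m < n" for m n
      using X_mono[of "Suc m" n] that Q(2)[of n] Q(4)[of m] by auto
    show ?thesis using that *[of m n] *[of n m] by (cases m n rule: linorder_cases) auto
  qed
  \<comment> \<open>The branch vertex \<open>q n\<close> belongs to both pieces: it ends
    \<open>S n\<close> on the spine and starts \<open>T n\<close>, which is trivial if
    \<open>B n\<close> is empty.\<close>
  define S where "S n = A n @ [q n]" for n
  define T where "T n = q n # B n" for n
  have SQ: "set (S n) \<subseteq> set (Q n)" and TQ: "set (T n) \<subseteq> set (Q n)" for n
    by (auto simp: S_def T_def Q_def)
  have ST: "set (S n) \<inter> set (T n) = {q n}" for n
    using Q(1)[of n] by (auto simp: S_def T_def Q_def vpath_def)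
  have "vpath (S n) G" for n
  proof -
    have "vwalk (S n @ B n) G" using Q(1)[of n] by (simp add: S_def Q_def vpath_def)
    then have "vwalk (S n) G" by (rule vwalkI_append_l[rotated]) (simp add: S_def)
    then show ?thesis using Q(1)[of n] by (simp add: S_def Q_def vpath_def)
  qed
  moreover have "set (S m) \<inter> set (S n) = {}" if "m \<noteq> n" for m n
    using Q_disj[OF that] SQ by blast
  \<comment> \<open>\<open>S (Suc n)\<close> and \<open>Q (Suc n)\<close> have the same head, also
    when \<open>A (Suc n)\<close> is empty: then it is \<open>q (Suc n)\<close>.\<close>
  moreover have "last (S n) \<rightarrow>\<^bsub>G\<^esub> hd (S (Suc n))" for n
    using Q(5)[of n] by (cases "A (Suc n)") (simp_all add: S_def Q_def)
  ultimately obtain R where R: "ray G R" "range R = (\<Union>n. set (S n))"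
    by (rule ray_of_paths)
  have T_path: "vpath (T n) G" for n
  proof -
    have "vwalk (A n @ T n) G" using Q(1)[of n] by (simp add: T_def Q_def vpath_def)
    then have "vwalk (T n) G" by (rule vwalkI_append_r[rotated]) (simp add: T_def)
    then show ?thesis using Q(1)[of n] by (simp add: T_def Q_def vpath_def)
  qed
  have T_R: "set (T n) \<inter> range R = {hd (T n)}" for n
  proof -
    have "x \<in> set (S n)" if "x \<in> set (T n)" "x \<in> set (S m)" for x m
      using Q_disj[of m n] SQ TQ that by (cases "m = n") blast+
    then have "set (T n) \<inter> range R = set (S n) \<inter> set (T n)" unfolding R(2) by blast
    then show ?thesis using ST by (simp add: T_def)
  qed
  have T_disj: "disjnt (set (T m)) (set (T n))" if "m \<noteq> n" for m n
    using Q_disj[OF that] TQ by (auto simp: disjnt_def)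
  \<comment> \<open>A comb has a set of paths, so infinitely many indices must give infinitely many
    paths.\<close>
  have "inj T"
  proof (rule injI, rule ccontr)
    fix m n assume "T m = T n" "m \<noteq> n"
    then show False using T_disj[of m n] by (simp add: T_def disjnt_def)
  qed
  then have "infinite (range T)" by (rule range_inj_infinite)
  moreover have "pairwise (\<lambda>p q. disjnt (set p) (set q)) (range T)"
  proof (rule pairwiseI)
    fix p q assume "p \<in> range T" "q \<in> range T" "p \<noteq> q"
    then obtain m n where "p = T m" "q = T n" "m \<noteq> n" by auto
    then show "disjnt (set p) (set q)" using T_disj by simp
  qed
  ultimately have "comb G R (range T)"
    using R(1) T_path T_R unfolding comb_def by blast
  moreover have "teeth (range T) \<subseteq> W"
    using Q(3) by (auto simp: teeth_def T_def Q_def)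
  ultimately show ?thesis by (auto simp: contains_comb_attached_to_def)
qed

section \<open>The dichotomy between combs and critical vertex sets\<close>

text \<open>Exactly one of two assertions holds precisely when the first is equivalent to the
  negation of the second.\<close>

theorem theorem3:
  fixes G :: "('a, 'b) pre_digraph" and U :: "'a set"
  assumes "simple_graph G" and "connected G" and "U \<subseteq> verts G"
  shows "contains_comb_attached_to G U \<longleftrightarrow>
    \<not> (\<forall>U'. U' \<subseteq> U \<and> infinite U' \<longrightarrow>
         (\<exists>X. critical G X \<and> infinite {C \<in> breve_C G X. verts C \<inter> U' \<noteq> {}}))"
proof -
  interpret sym_digraph G using assms(1) by (simp add: simple_graph_def)
  show ?thesis
  proof
    assume "contains_comb_attached_to G U"
    then obtain R P where comb: "comb G R P" and P: "teeth P \<subseteq> U"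
      by (auto simp: contains_comb_attached_to_def)
    \<comment> \<open>The components in \<open>breve_C G X\<close> are among those of
      \<open>G - X\<close>, of which only finitely many contain teeth.\<close>
    have "finite {C \<in> breve_C G X. verts C \<inter> teeth P \<noteq> {}}" if "critical G X" for X
    proof (rule finite_subset)
      show "finite {C \<in> components (G \<restriction> (verts G - X)). verts C \<inter> teeth P \<noteq> {}}"
        using comb that by (intro comb_tooth_components_finite) (auto simp: critical_def)
    qed (auto simp: breve_C_def)
    then show "\<not> (\<forall>U'. U' \<subseteq> U \<and> infinite U' \<longrightarrow>
         (\<exists>X. critical G X \<and> infinite {C \<in> breve_C G X. verts C \<inter> U' \<noteq> {}}))"
      using P comb_imp_infinite_teeth[OF comb] by blast
  next
    assume "\<not> (\<forall>U'. U' \<subseteq> U \<and> infinite U' \<longrightarrow>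
         (\<exists>X. critical G X \<and> infinite {C \<in> breve_C G X. verts C \<inter> U' \<noteq> {}}))"
    then obtain W where W: "W \<subseteq> U" "infinite W"
      and "\<nexists>X. critical G X \<and> infinite {C \<in> breve_C G X. verts C \<inter> W \<noteq> {}}" by blast
    then have "finite {C \<in> components (G \<restriction> (verts G - X)). verts C \<inter> W \<noteq> {}}" if "finite X" for X
      using ex_critical that by blast
    then have "contains_comb_attached_to G W"
      using ex_comb assms(2,3) W by blast
    then show "contains_comb_attached_to G U"
      using W(1) unfolding contains_comb_attached_to_def by blast
  qed
qed

end
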